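(* Let $A=(0,a_2,a_3,\dots)$ be a sequence of nonnegative integers (with $a_1=0$). The limiting distribution of $\omega_A(n)$, i.e. the distribution of a random variable $X_A$ taking each value $m\in\{0,1,2,\dots\}$ with probability $e_{A,m}$, has expectation $$\sum_{p} \sum_{j=2}^{\infty}a_j\Bigl(\frac{1}{p^{j}}-\frac{1}{p^{j+1}} \Bigr)$$ (as an identity in $[0,\infty]$; the expectation may be infinite).
   Context: For a positive integer $n$ and $j\geqslant1$, $\omega_j(n)$ is the number of primes $p$ with $p^j\,\|\,n$ (primes dividing $n$ with multiplicity exactly $j$). For a sequence $A=(a_1,a_2,\dots)$, $\omega_A(n)=\sum_{j=1}^\infty a_j\omega_j(n)$ (a finite sum for each $n$). $e_{A,m}=\lim_{x\to\infty}\frac1x\#\{n\leqslant x:\omega_A(n)=m\}$ is the natural density of the positive integers $n$ with $\omega_A(n)=m$; for $A$ as in the claim these limits exist, are nonnegative, and satisfy $\sum_{m\geqslant0}e_{A,m}=1$. $\sum_p$ denotes a sum over all primes. *)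

theory Defs
  imports "HOL-Probability.Probability" "HOL-Computational_Algebra.Primes"
begin

definition omega_exact :: "nat \<Rightarrow> nat \<Rightarrow> nat" where
  "omega_exact j n = card {p::nat. prime p \<and> multiplicity p n = j}"

text \<open>
  A sequence is a function on \<open>nat\<close> of which only the values at indices \<open>j \<ge> 1\<close> are used.
  For \<open>n > 0\<close> only finitely many summands are nonzero, so that the infinite sum
  over the (discrete) natural numbers is the ordinary finite sum.
\<close>
definition omega_seq :: "(nat \<Rightarrow> nat) \<Rightarrow> nat \<Rightarrow> nat" where
  "omega_seq a n = (\<Sum>\<^sub>\<infinity>j\<in>{1..}. a j * omega_exact j n)"

lemma omega_seq_eq_sum:
  assumes n: "n > 0"
  shows "omega_seq a n = (\<Sum>j=1..n. a j * omega_exact j n)"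
proof -
  have "omega_exact j n = 0" if "j > n" for j
  proof -
    have "{p::nat. prime p \<and> multiplicity p n = j} = {}"
    proof safe
      fix p assume p: "prime (p::nat)" "j = multiplicity p n"
      have "p ^ multiplicity p n dvd n" by (rule multiplicity_dvd)
      then have "p ^ j \<le> n" using n p dvd_imp_le by auto
      moreover have "j < 2 ^ j" by simp
      moreover have "2 ^ j \<le> p ^ j" using p by (simp add: power_mono prime_ge_2_nat)
      ultimately show "p \<in> {}" using that by linarith
    qed
    then show ?thesis unfolding omega_exact_def by (simp only: card.empty)
  qed
  then have "omega_seq a n = (\<Sum>\<^sub>\<infinity>j\<in>{1..n}. a j * omega_exact j n)"
    unfolding omega_seq_def by (intro infsum_cong_neutral) auto
  then show ?thesis by simp
qed

definition counting_ratio :: "nat set \<Rightarrow> real \<Rightarrow> real" where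
  "counting_ratio S x = real (card {n \<in> S. 0 < n \<and> real n \<le> x}) / x"

definition has_natural_density :: "nat set \<Rightarrow> real \<Rightarrow> bool" where
  "has_natural_density S d \<longleftrightarrow> (counting_ratio S \<longlongrightarrow> d) at_top"

text \<open>Meaningful only for sets that have a natural density (the limit is unspecified otherwise).\<close>
definition natural_density :: "nat set \<Rightarrow> real" where
  "natural_density S = Lim at_top (counting_ratio S)"

definition omega_density :: "(nat \<Rightarrow> nat) \<Rightarrow> nat \<Rightarrow> real" where
  "omega_density a m = natural_density {n. 0 < n \<and> omega_seq a n = m}"

end

theory Submission imports Defs begin

text \<open>
  Because \<open>a 1 = 0\<close>, only prime powers \<open>p\<^sup>j\<close> with \<open>j \<ge> 2\<close> contribute to \<open>omega_seq a\<close>, and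
  these are rare. Keeping only the contributions with \<open>p \<le> K\<close> and \<open>j < 2 * K\<close> gives a
  truncation \<open>omega_trunc a K\<close> that is bounded and periodic, so all its averages over
  \<open>{1..N}\<close> converge. The truncation agrees with \<open>omega_seq a\<close> at every \<open>n > 0\<close> that has no square
  divisor \<open>d\<^sup>2\<close> with \<open>d > K\<close> (lemma \<open>omega_seq_eq_omega_trunc\<close>), and among the first \<open>N\<close>
  positive integers at most \<open>N * (\<Sum>d>K. 1 / d\<^sup>2) \<le> N / K\<close> fail this
  (\<open>average_large_square_divisor_le\<close>). This bound is uniform in \<open>N\<close>, so limits in \<open>N\<close> and \<open>K\<close>
  may be interchanged: the set of \<open>n\<close> with \<open>m \<le> omega_seq a n\<close> has a density \<open>T m\<close>, the limit of
  the corresponding densities \<open>t K m\<close> of the truncations, and \<open>T m \<longlonglongrightarrow> 0\<close> since each truncation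
  is bounded. Hence \<open>omega_density a m = T m - T (Suc m)\<close>, and these numbers telescope to
  \<open>T 0 = 1\<close>.

  The expectation is the sum of the tail probabilities, \<open>\<Sum>m. T (Suc m)\<close>. For fixed \<open>K\<close> the sum
  \<open>\<Sum>m. t K (Suc m)\<close> is the mean value of \<open>omega_trunc a K\<close>, which by linearity is the part
  \<open>p \<le> K\<close>, \<open>j < 2 * K\<close> of the claimed double series, as \<open>p\<^sup>j\<close> exactly divides \<open>n\<close> with density
  \<open>1 / p ^ j - 1 / p ^ (j + 1)\<close>. Both the truncations and the partial sums increase with \<open>K\<close>, so
  monotone convergence gives the identity in \<open>[0, \<infinity>]\<close>.
\<close>

section \<open>Mean values of arithmetic functions\<close>

definition average :: "(nat \<Rightarrow> real) \<Rightarrow> nat \<Rightarrow> real" where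
  "average h N = (\<Sum>n=1..N. h n) / real N"

definition has_mean :: "(nat \<Rightarrow> real) \<Rightarrow> real \<Rightarrow> bool" where
  "has_mean h c \<longleftrightarrow> average h \<longlonglongrightarrow> c"

lemma average_mono: "(\<And>n. h n \<le> g n) \<Longrightarrow> average h N \<le> average g N"
  unfolding average_def by (intro divide_right_mono sum_mono) auto

lemma average_close:
  assumes "\<And>n. n > 0 \<Longrightarrow> \<bar>f n - g n\<bar> \<le> h n"
  shows "\<bar>average f N - average g N\<bar> \<le> average h N"
proof -
  have "average f N - average g N = (\<Sum>n=1..N. f n - g n) / real N"
    by (simp add: average_def sum_subtractf diff_divide_distrib)
  moreover have "\<bar>\<Sum>n=1..N. f n - g n\<bar> \<le> (\<Sum>n=1..N. h n)"
    using assms by (intro order_trans[OF sum_abs] sum_mono) auto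
  ultimately show ?thesis by (simp add: average_def abs_divide divide_right_mono)
qed

lemma has_mean_mono:
  assumes "has_mean h c" "has_mean g d" "\<And>n. h n \<le> g n"
  shows "c \<le> d"
  using LIMSEQ_le[of "average h" c "average g" d] assms average_mono[of h g]
  unfolding has_mean_def by blast

lemma has_mean_unique: "has_mean h c \<Longrightarrow> has_mean h d \<Longrightarrow> c = d"
  unfolding has_mean_def by (rule LIMSEQ_unique)

lemma has_mean_const: "has_mean (\<lambda>_. c) c"
  unfolding has_mean_def
proof (rule tendsto_eventually)
  show "\<forall>\<^sub>F N in sequentially. average (\<lambda>_. c) N = c"
    using eventually_gt_at_top[of 0] by eventually_elim (simp add: average_def)
qed

lemma has_mean_diff: "has_mean h c \<Longrightarrow> has_mean g d \<Longrightarrow> has_mean (\<lambda>n. h n - g n) (c - d)"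
  unfolding has_mean_def average_def sum_subtractf diff_divide_distrib by (rule tendsto_diff)

lemma has_mean_cmult: "has_mean h c \<Longrightarrow> has_mean (\<lambda>n. k * h n) (k * c)"
  unfolding has_mean_def average_def sum_distrib_left[symmetric] times_divide_eq_right[symmetric]
  by (rule tendsto_mult_left)

lemma has_mean_sum:
  assumes "\<And>i. i \<in> I \<Longrightarrow> has_mean (h i) (c i)"
  shows "has_mean (\<lambda>n. \<Sum>i\<in>I. h i n) (\<Sum>i\<in>I. c i)"
proof -
  have "average (\<lambda>n. \<Sum>i\<in>I. h i n) = (\<lambda>N. \<Sum>i\<in>I. average (h i) N)"
    unfolding average_def by (subst sum.swap) (simp add: sum_divide_distrib)
  then show ?thesis using assms unfolding has_mean_def by (auto intro: tendsto_sum)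
qed

lemma periodic_mod:
  fixes g :: "nat \<Rightarrow> 'c"
  assumes "\<And>n. g (n + Q) = g n"
  shows "g n = g (n mod Q)"
proof -
  have "g (r + k * Q) = g r" for r k
    by (induction k) (use assms[of "r + _ * Q"] in \<open>simp_all add: algebra_simps\<close>)
  then show ?thesis by (metis mod_div_mult_eq)
qed

text \<open>
  Subtracting the linear function of slope \<open>S / Q\<close>, where \<open>S\<close> is the sum over the first
  period, turns the partial sums themselves into a periodic and therefore bounded function.
\<close>
lemma has_mean_periodic:
  assumes per: "\<And>n. h (n + Q) = h n" and Q: "Q > 0"
  shows "has_mean h ((\<Sum>n=1..Q. h n) / real Q)"
proof -
  define S where "S = (\<Sum>n=1..Q. h n)"
  define g where "g N = (\<Sum>n=1..N. h n) - real N * (S / real Q)" for N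
  have "g (N + Q) = g N" for N
  proof -
    have "(\<Sum>n=1..Q + N. h n) = S + (\<Sum>n=Suc Q..Q + N. h n)"
      unfolding S_def by (subst sum.ub_add_nat) auto
    also have "(\<Sum>n=Suc Q..Q + N. h n) = (\<Sum>n=1..N. h (n + Q))"
      using sum.shift_bounds_cl_nat_ivl[of h 1 Q N] by (simp add: add.commute)
    finally show ?thesis using Q by (simp add: g_def per add.commute field_simps)
  qed
  then have gmod: "g N = g (N mod Q)" for N by (rule periodic_mod)
  have bdd: "\<bar>g N\<bar> \<le> (\<Sum>r<Q. \<bar>g r\<bar>)" for N
    by (subst gmod, rule member_le_sum[of "N mod Q" "{..<Q}" "\<lambda>r. \<bar>g r\<bar>"]) (use Q in auto)
  have "(\<lambda>N. g N / real N) \<longlonglongrightarrow> 0"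
  proof (rule Lim_null_comparison)
    show "\<forall>\<^sub>F N in sequentially. norm (g N / real N) \<le> (\<Sum>r<Q. \<bar>g r\<bar>) / real N"
      using bdd by (auto simp: abs_divide divide_right_mono)
    show "(\<lambda>N. (\<Sum>r<Q. \<bar>g r\<bar>) / real N) \<longlonglongrightarrow> 0"
      by (rule lim_const_over_n)
  qed
  then have "(\<lambda>N. g N / real N + S / real Q) \<longlonglongrightarrow> 0 + S / real Q"
    by (intro tendsto_add tendsto_const)
  moreover have "\<forall>\<^sub>F N in sequentially. g N / real N + S / real Q = average h N"
    using eventually_gt_at_top[of 0]
    by eventually_elim (simp add: g_def average_def field_simps)
  ultimately show ?thesis
    unfolding has_mean_def S_def by (simp add: tendsto_cong)
qed

lemma has_mean_dvd:
  assumes "d > 0"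
  shows "has_mean (\<lambda>n. of_bool (d dvd n)) (1 / real d)"
proof -
  have "{n \<in> {1..d}. d dvd n} = {d}" using assms by (auto dest: dvd_imp_le)
  then have "(\<Sum>n=1..d. of_bool (d dvd n)) = (1::real)"
    by (simp add: sum.inter_filter[symmetric] of_bool_def)
  with has_mean_periodic[of "\<lambda>n. of_bool (d dvd n)" d] assms show ?thesis by simp
qed

text \<open>
  Densities are limits over real \<open>x\<close>, mean values limits over integers; the two ratios differ
  by the factor \<open>\<lfloor>x\<rfloor> / x\<close>, which tends to \<open>1\<close>.
\<close>
lemma has_mean_imp_has_natural_density:
  assumes "has_mean (\<lambda>n. of_bool (n \<in> S)) d"
  shows "has_natural_density S d"
proof -
  let ?h = "\<lambda>n. of_bool (n \<in> S) :: real"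
  have eq: "counting_ratio S x = average ?h (nat \<lfloor>x\<rfloor>) * (real (nat \<lfloor>x\<rfloor>) / x)" if "x \<ge> 1" for x
  proof -
    have "{n \<in> S. 0 < n \<and> real n \<le> x} = {1..nat \<lfloor>x\<rfloor>} \<inter> S"
      using that by (auto simp: le_nat_floor le_nat_iff le_floor_iff) 
    then show ?thesis using that
      by (simp add: counting_ratio_def average_def of_bool_def sum.If_cases Int_def)
  qed
  have "((\<lambda>x. average ?h (nat \<lfloor>x\<rfloor>)) \<longlongrightarrow> d) at_top"
    using assms unfolding has_mean_def
    by (rule filterlim_compose)
       (intro filterlim_compose[OF filterlim_nat_sequentially] filterlim_floor_sequentially)
  moreover have "((\<lambda>x. real (nat \<lfloor>x\<rfloor>) / x) \<longlongrightarrow> 1) at_top"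
  proof (rule tendsto_sandwich)
    have "1 - 1 / x \<le> real (nat \<lfloor>x\<rfloor>) / x" if "x > 0" for x :: real
    proof -
      have "x - 1 \<le> real (nat \<lfloor>x\<rfloor>)" using that by linarith
      then have "(x - 1) / x \<le> real (nat \<lfloor>x\<rfloor>) / x" using that by (intro divide_right_mono) auto
      then show ?thesis using that by (simp add: diff_divide_distrib)
    qed
    then show "\<forall>\<^sub>F x in at_top. 1 - 1 / x \<le> real (nat \<lfloor>x\<rfloor>) / x"
      using eventually_gt_at_top[of 0] by (rule eventually_mono[rotated])
    show "\<forall>\<^sub>F x in at_top. real (nat \<lfloor>x\<rfloor>) / x \<le> 1"
      using eventually_gt_at_top[of 0] by eventually_elim (simp add: of_nat_floor)
    show "((\<lambda>x::real. 1 - 1 / x) \<longlongrightarrow> 1) at_top"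
      using tendsto_diff[OF tendsto_const tendsto_inverse_0_at_top[OF filterlim_ident]]
      by (simp add: inverse_eq_divide)
  qed auto
  ultimately have "((\<lambda>x. average ?h (nat \<lfloor>x\<rfloor>) * (real (nat \<lfloor>x\<rfloor>) / x)) \<longlongrightarrow> d * 1) at_top"
    by (rule tendsto_mult)
  moreover have "\<forall>\<^sub>F x in at_top.
      average ?h (nat \<lfloor>x\<rfloor>) * (real (nat \<lfloor>x\<rfloor>) / x) = counting_ratio S x"
    using eventually_ge_at_top[of 1] by eventually_elim (simp add: eq)
  ultimately show ?thesis
    unfolding has_natural_density_def by (simp add: tendsto_cong)
qed

lemma natural_density_eqI: "has_natural_density S d \<Longrightarrow> natural_density S = d"
  unfolding has_natural_density_def natural_density_def by (rule tendsto_Lim) auto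

text \<open>
  An interchange of limits. It is used in two ways: with averages over \<open>{1..N}\<close>, to transfer
  the densities of the truncations to \<open>omega_seq a\<close>, and with tail densities as functions of
  the threshold, to see that they vanish at infinity.
\<close>
lemma tendsto_uniform_approx:
  fixes x :: "nat \<Rightarrow> nat \<Rightarrow> real"
  assumes x: "\<And>K. x K \<longlonglongrightarrow> c K" and c: "c \<longlonglongrightarrow> L" and e: "e \<longlonglongrightarrow> 0"
    and close: "\<And>K N. K \<ge> 1 \<Longrightarrow> \<bar>y N - x K N\<bar> \<le> e K"
  shows "y \<longlonglongrightarrow> L"
proof (rule LIMSEQ_I)
  fix r :: real assume r: "r > 0"
  have "\<forall>\<^sub>F K in sequentially. \<bar>c K - L\<bar> < r / 3"
    using tendstoD[OF c, of "r / 3"] r by (simp add: dist_real_def)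
  moreover have "\<forall>\<^sub>F K in sequentially. \<bar>e K\<bar> < r / 3"
    using tendstoD[OF e, of "r / 3"] r by simp
  ultimately have "\<forall>\<^sub>F K in sequentially. \<bar>c K - L\<bar> < r / 3 \<and> \<bar>e K\<bar> < r / 3 \<and> K \<ge> 1"
    using eventually_ge_at_top[of 1] by eventually_elim auto
  then obtain K where K: "\<bar>c K - L\<bar> < r / 3" "\<bar>e K\<bar> < r / 3" "K \<ge> 1"
    by (auto simp: eventually_sequentially)
  obtain n0 where n0: "\<And>N. N \<ge> n0 \<Longrightarrow> \<bar>x K N - c K\<bar> < r / 3"
    using LIMSEQ_D[OF x[of K], of "r / 3"] r by auto
  have "norm (y N - L) < r" if "N \<ge> n0" for N
    using n0[OF that] K close[OF K(3), of N] by (simp only: real_norm_def)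
  then show "\<exists>no. \<forall>n\<ge>no. norm (y n - L) < r" by blast
qed

section \<open>Integers with a large square divisor\<close>

lemma card_multiples_le:
  assumes "m > 0"
  shows "real (card {n \<in> {1..N}. m dvd n}) \<le> real N / real m"
proof -
  have "{n \<in> {1..N}. m dvd n} \<subseteq> (\<lambda>k. m * k) ` {1..N div m}"
    using assms by (auto elim!: dvdE simp: less_eq_div_iff_mult_less_eq mult.commute)
  then have "card {n \<in> {1..N}. m dvd n} \<le> N div m"
    using surj_card_le[of "{1..N div m}" "{n \<in> {1..N}. m dvd n}" "\<lambda>k. m * k"] by simp
  also have "real (N div m) \<le> real N / real m" by (rule of_nat_div_le_of_nat)
  finally show ?thesis by simp
qed

lemma sum_inverse_squares_tail_le:
  assumes "K \<ge> 1"
  shows "(\<Sum>d\<in>{K<..N}. 1 / real (d ^ 2)) \<le> 1 / real K"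
proof (cases "K \<le> N")
  case True
  (* 1 / (n + 1)^2 is at most 1 / n - 1 / (n + 1), and these differences telescope *)
  then have "(\<Sum>d\<in>{K<..N}. 1 / real (d ^ 2)) \<le> 1 / real K - 1 / real N"
  proof (induction N rule: dec_induct)
    case (step n)
    have "{K<..Suc n} = insert (Suc n) {K<..n}" using step.hyps by auto
    then have "(\<Sum>d\<in>{K<..Suc n}. 1 / real (d ^ 2)) \<le> 1 / real (Suc n ^ 2) + (1 / real K - 1 / real n)"
      using step.IH by simp
    also have "1 / real (Suc n ^ 2) \<le> 1 / real n - 1 / real (Suc n)"
    proof -
      have "1 / real (Suc n ^ 2) \<le> 1 / (real n * real (Suc n))"
        unfolding power2_eq_square of_nat_mult
        using step.hyps assms by (intro divide_left_mono mult_right_mono) auto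
      also have "\<dots> = 1 / real n - 1 / real (Suc n)"
        using step.hyps assms by (simp add: field_simps)
      finally show ?thesis .
    qed
    finally show ?case by simp
  qed auto
  also have "\<dots> \<le> 1 / real K" by simp
  finally show ?thesis .
qed auto

text \<open>A union bound over \<open>d\<close>, where the multiples of \<open>d\<^sup>2\<close> number at most \<open>N / d\<^sup>2\<close>.\<close>
lemma average_large_square_divisor_le:
  assumes K: "K \<ge> 1"
  shows "average (\<lambda>n. of_bool (\<exists>d>K. d ^ 2 dvd n)) N \<le> 1 / real K"
proof (cases "N = 0")
  case False
  let ?B = "{n \<in> {1..N}. \<exists>d>K. d ^ 2 dvd n}"
  have sub: "?B \<subseteq> (\<Union>d\<in>{K<..N}. {n \<in> {1..N}. d ^ 2 dvd n})"
  proof safe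
    fix n d assume n: "n \<in> {1..N}" and d: "K < d" "d ^ 2 dvd n"
    have "d \<le> d ^ 2" by (simp add: power2_eq_square)
    also have "\<dots> \<le> n" using d n by (auto dest: dvd_imp_le)
    finally show "n \<in> (\<Union>d\<in>{K<..N}. {n \<in> {1..N}. d ^ 2 dvd n})" using n d by auto
  qed
  have "card ?B \<le> card (\<Union>d\<in>{K<..N}. {n \<in> {1..N}. d ^ 2 dvd n})"
    by (rule card_mono[OF _ sub]) auto
  also have "\<dots> \<le> (\<Sum>d\<in>{K<..N}. card {n \<in> {1..N}. d ^ 2 dvd n})"
    by (rule card_UN_le) auto
  finally have "real (card ?B) \<le> (\<Sum>d\<in>{K<..N}. real (card {n \<in> {1..N}. d ^ 2 dvd n}))"
    by (simp flip: of_nat_sum)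
  also have "\<dots> \<le> (\<Sum>d\<in>{K<..N}. real N / real (d ^ 2))"
    by (intro sum_mono card_multiples_le) auto
  also have "\<dots> = real N * (\<Sum>d\<in>{K<..N}. 1 / real (d ^ 2))" by (simp add: sum_distrib_left)
  also have "\<dots> \<le> real N * (1 / real K)"
    by (intro mult_left_mono sum_inverse_squares_tail_le K) auto
  finally show ?thesis using False
    by (simp add: average_def of_bool_def sum.If_cases Int_def field_simps)
qed (simp add: average_def)

section \<open>Periodic truncations\<close>

text \<open>
  Stated by divisibility instead of \<open>multiplicity p n = j\<close> to make it apparent that the
  condition depends on \<open>n\<close> modulo \<open>p ^ Suc j\<close> only.
\<close>
definition exactly_divides :: "nat \<Rightarrow> nat \<Rightarrow> nat \<Rightarrow> bool" where
  "exactly_divides p j n \<longleftrightarrow> p ^ j dvd n \<and> \<not> p ^ Suc j dvd n"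

text \<open>
  The exponents run up to \<open>2 * K\<close>, and not up to \<open>K\<close>, so that a larger exponent still leaves the
  square of \<open>p ^ K > K\<close> as a divisor.
\<close>
definition omega_trunc :: "(nat \<Rightarrow> nat) \<Rightarrow> nat \<Rightarrow> nat \<Rightarrow> nat" where
  "omega_trunc a K n =
     (\<Sum>p | prime p \<and> p \<le> K. \<Sum>j\<in>{2..<2*K}. a j * of_bool (exactly_divides p j n))"

lemma exactly_divides_iff_multiplicity:
  assumes "prime p" "n > 0"
  shows "exactly_divides p j n \<longleftrightarrow> multiplicity p n = j"
  using assms unfolding exactly_divides_def
  by (subst (1 2) power_dvd_iff_le_multiplicity) (auto simp: prime_gt_1_nat)

lemma has_mean_exactly_divides:
  assumes "p > 0"
  shows "has_mean (\<lambda>n. of_bool (exactly_divides p j n)) (1 / real p ^ j - 1 / real p ^ (j + 1))"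
proof -
  have "(\<lambda>n. of_bool (exactly_divides p j n) :: real)
      = (\<lambda>n. of_bool (p ^ j dvd n) - of_bool (p ^ Suc j dvd n))"
    using power_le_dvd[of p "Suc j" _ j] by (auto simp: exactly_divides_def fun_eq_iff simp del: power_Suc)
  then show ?thesis
    using has_mean_diff[OF has_mean_dvd[of "p ^ j"] has_mean_dvd[of "p ^ Suc j"]] assms by simp
qed

lemma has_mean_omega_trunc:
  "has_mean (\<lambda>n. real (omega_trunc a K n))
     (\<Sum>p | prime p \<and> p \<le> K. \<Sum>j\<in>{2..<2*K}. real (a j) * (1 / real p ^ j - 1 / real p ^ (j + 1)))"
  unfolding omega_trunc_def of_nat_sum of_nat_mult of_nat_of_bool
  by (intro has_mean_sum has_mean_cmult has_mean_exactly_divides) (auto dest: prime_gt_0_nat)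

text \<open>
  For \<open>p \<le> K\<close> and \<open>i \<le> 2 * K\<close> the power \<open>p ^ i\<close> divides \<open>fact K ^ (2 * K)\<close>, because \<open>p\<close> divides
  \<open>fact K\<close>.
\<close>
lemma omega_trunc_periodic: "omega_trunc a K (n + fact K ^ (2 * K)) = omega_trunc a K n"
proof -
  have dvd: "p ^ i dvd n + fact K ^ (2 * K) \<longleftrightarrow> p ^ i dvd n" if "prime p" "p \<le> K" "i \<le> 2 * K" for p i
  proof -
    have "p dvd fact K" using that by (simp add: dvd_fact prime_gt_0_nat Suc_leI)
    then have "p ^ i dvd fact K ^ (2 * K)"
      using that by (meson dvd_power_same dvd_trans le_imp_power_dvd)
    then show ?thesis by (simp add: dvd_add_left_iff)
  qed
  show ?thesis unfolding omega_trunc_def exactly_divides_def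
    by (intro sum.cong refl) (simp add: dvd del: power_Suc)
qed

lemma omega_trunc_mono:
  assumes "K \<le> L"
  shows "omega_trunc a K n \<le> omega_trunc a L n"
proof -
  have "omega_trunc a K n \<le> 
     (\<Sum>p | prime p \<and> p \<le> K. \<Sum>j\<in>{2..<2*L}. a j * of_bool (exactly_divides p j n))"
    unfolding omega_trunc_def using assms by (intro sum_mono sum_mono2) auto
  also have "\<dots> \<le> omega_trunc a L n"
    unfolding omega_trunc_def using assms by (intro sum_mono2) auto
  finally show ?thesis .
qed

lemma omega_trunc_le: "omega_trunc a K n \<le> (\<Sum>p | prime p \<and> p \<le> K. \<Sum>j\<in>{2..<2*K}. a j)"
  unfolding omega_trunc_def by (intro sum_mono) auto

text \<open>
  A prime power \<open>p\<^sup>j\<close> with \<open>j \<ge> 2\<close> that exactly divides \<open>n\<close> and is missed by the truncation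
  has \<open>p > K\<close> or \<open>j \<ge> 2 * K\<close>. In the first case \<open>p\<close>, in the second case \<open>p ^ K > K\<close> is a number
  above \<open>K\<close> whose square divides \<open>n\<close>.
\<close>
lemma omega_seq_eq_omega_trunc:
  assumes a1: "a 1 = 0" and n: "n > 0" and no: "\<not> (\<exists>d>K. d ^ 2 dvd n)"
  shows "omega_seq a n = omega_trunc a K n"
proof -
  have missed: "p \<le> K \<and> j < 2 * K" if p: "prime p" and j: "multiplicity p n = j" "j \<ge> 2" for p j
  proof (rule conjI; rule ccontr)
    assume "\<not> p \<le> K"
    moreover have "p ^ 2 dvd n" using j by (simp add: multiplicity_dvd')
    ultimately show False using no by (meson not_le)
  next
    assume "\<not> j < 2 * K"
    then have "p ^ (K * 2) dvd n" using j by (intro multiplicity_dvd') auto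
    then have "(p ^ K) ^ 2 dvd n" by (simp add: power_mult)
    moreover have "K < p ^ K"
      using prime_ge_2_nat[OF p] less_exp[of K] power_mono[of 2 p K] by linarith
    ultimately show False using no by blast
  qed
  have "omega_seq a n = (\<Sum>\<^sub>\<infinity>j\<in>{2..<2*K}. a j * card {p. prime p \<and> p \<le> K \<and> exactly_divides p j n})"
    unfolding omega_seq_def
  proof (rule infsum_cong_neutral)
    fix j assume j: "j \<in> {1..} - {2..<2*K}"
    show "a j * omega_exact j n = 0"
    proof (cases "j = 1")
      case False
      then have "{p. prime p \<and> multiplicity p n = j} = {}" using j missed by force
      then show ?thesis unfolding omega_exact_def by (simp only: card.empty)
    qed (use a1 in simp)
  next
    fix j assume j: "j \<in> {1..} \<inter> {2..<2*K}"
    have "{p. prime p \<and> multiplicity p n = j} = {p. prime p \<and> p \<le> K \<and> exactly_divides p j n}"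
      using j missed n by (auto simp: exactly_divides_iff_multiplicity)
    then show "a j * omega_exact j n = a j * card {p. prime p \<and> p \<le> K \<and> exactly_divides p j n}"
      unfolding omega_exact_def by simp
  qed auto
  also have "\<dots> = omega_trunc a K n"
  proof -
    have "card {p. prime p \<and> p \<le> K \<and> exactly_divides p j n}
        = (\<Sum>p | prime p \<and> p \<le> K. of_bool (exactly_divides p j n))" for j
      by (simp add: of_bool_def sum.If_cases Int_def conj_assoc)
    then show ?thesis
      unfolding omega_trunc_def by (subst sum.swap) (simp add: sum_distrib_left[symmetric] del: sum.cong)
  qed
  finally show ?thesis .
qed

section \<open>Tail densities\<close>

text \<open>The density of the set of \<open>n\<close> with \<open>m \<le> omega_trunc a K n\<close>, which exists by periodicity.\<close>
definition trunc_tail :: "(nat \<Rightarrow> nat) \<Rightarrow> nat \<Rightarrow> nat \<Rightarrow> real" where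
  "trunc_tail a K m = lim (average (\<lambda>n. of_bool (m \<le> omega_trunc a K n)))"

lemma has_mean_trunc_tail: "has_mean (\<lambda>n. of_bool (m \<le> omega_trunc a K n)) (trunc_tail a K m)"
proof -
  obtain c where "has_mean (\<lambda>n. of_bool (m \<le> omega_trunc a K n)) c"
    using has_mean_periodic[of "\<lambda>n. of_bool (m \<le> omega_trunc a K n)" "fact K ^ (2 * K)"]
    by (auto simp: omega_trunc_periodic)
  then show ?thesis by (simp add: has_mean_def trunc_tail_def limI)
qed

lemma trunc_tail_nonneg: "0 \<le> trunc_tail a K m"
  by (rule has_mean_mono[OF has_mean_const has_mean_trunc_tail]) simp

lemma trunc_tail_le_1: "trunc_tail a K m \<le> 1"
  by (rule has_mean_mono[OF has_mean_trunc_tail has_mean_const]) simp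

lemma trunc_tail_mono: "K \<le> L \<Longrightarrow> trunc_tail a K m \<le> trunc_tail a L m"
  by (rule has_mean_mono[OF has_mean_trunc_tail has_mean_trunc_tail])
     (auto dest: le_trans[OF _ omega_trunc_mono])

lemma trunc_tail_eq_0:
  assumes "(\<Sum>p | prime p \<and> p \<le> K. \<Sum>j\<in>{2..<2*K}. a j) < m"
  shows "trunc_tail a K m = 0"
proof -
  have "(\<lambda>n. of_bool (m \<le> omega_trunc a K n)) = (\<lambda>_. 0 :: real)"
    using le_less_trans[OF omega_trunc_le assms] by (auto simp: fun_eq_iff not_le)
  then show ?thesis using has_mean_trunc_tail[of m a K] has_mean_const[of 0] has_mean_unique by metis
qed

text \<open>
  The layer-cake formula for \<open>omega_trunc a K\<close>: a natural number \<open>k \<le> B\<close> is the number of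
  \<open>m < B\<close> with \<open>Suc m \<le> k\<close>, and boundedness makes the sum over \<open>m\<close> finite, so that taking
  means termwise is linearity.
\<close>
lemma suminf_trunc_tail:
  "(\<Sum>m. ennreal (trunc_tail a K (Suc m))) =
     ennreal (\<Sum>p | prime p \<and> p \<le> K. \<Sum>j\<in>{2..<2*K}. real (a j) * (1 / real p ^ j - 1 / real p ^ (j + 1)))"
proof -
  define B where "B = (\<Sum>p | prime p \<and> p \<le> K. \<Sum>j\<in>{2..<2*K}. a j)"
  have "real (omega_trunc a K n) = (\<Sum>m<B. of_bool (Suc m \<le> omega_trunc a K n))" for n
  proof -
    have "{m. m < B \<and> Suc m \<le> omega_trunc a K n} = {..<omega_trunc a K n}"
      using omega_trunc_le[of a K n] by (auto simp: B_def)
    then show ?thesis by (simp add: of_bool_def sum.If_cases Int_def)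
  qed
  then have "has_mean (\<lambda>n. real (omega_trunc a K n)) (\<Sum>m<B. trunc_tail a K (Suc m))"
    by (simp only:) (intro has_mean_sum has_mean_trunc_tail)
  with has_mean_omega_trunc[of a K]
  have *: "(\<Sum>m<B. trunc_tail a K (Suc m))
      = (\<Sum>p | prime p \<and> p \<le> K. \<Sum>j\<in>{2..<2*K}. real (a j) * (1 / real p ^ j - 1 / real p ^ (j + 1)))"
    using has_mean_unique by blast
  have "(\<Sum>m. ennreal (trunc_tail a K (Suc m))) = (\<Sum>m<B. ennreal (trunc_tail a K (Suc m)))"
    by (rule suminf_finite) (auto simp: trunc_tail_eq_0 B_def)
  also have "\<dots> = ennreal (\<Sum>m<B. trunc_tail a K (Suc m))"
    by (simp add: trunc_tail_nonneg)
  finally show ?thesis unfolding * .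
qed

text \<open>
  Defined through the truncations, so that monotone convergence in \<open>K\<close> applies directly; that
  it is, for \<open>a 1 = 0\<close>, the density of the \<open>n\<close> with \<open>m \<le> omega_seq a n\<close> is \<open>has_mean_tail_density\<close> below.
\<close>
definition tail_density :: "(nat \<Rightarrow> nat) \<Rightarrow> nat \<Rightarrow> real" where
  "tail_density a m = lim (\<lambda>K. trunc_tail a K m)"

lemma trunc_tail_tendsto: "(\<lambda>K. trunc_tail a K m) \<longlonglongrightarrow> tail_density a m"
proof -
  have "incseq (\<lambda>K. trunc_tail a K m)" by (simp add: incseq_def trunc_tail_mono)
  then obtain L where "(\<lambda>K. trunc_tail a K m) \<longlonglongrightarrow> L"
    by (rule incseq_convergent[of _ 1]) (use trunc_tail_le_1 in auto)
  then show ?thesis by (simp add: tail_density_def limI)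
qed

lemma average_tail_close:
  assumes a1: "a 1 = 0" and K: "K \<ge> 1"
  shows "\<bar>average (\<lambda>n. of_bool (m \<le> omega_seq a n)) N
          - average (\<lambda>n. of_bool (m \<le> omega_trunc a K n)) N\<bar> \<le> 1 / real K"
proof -
  let ?f = "\<lambda>n. of_bool (m \<le> omega_seq a n) :: real"
  let ?g = "\<lambda>n. of_bool (m \<le> omega_trunc a K n) :: real"
  have "\<bar>?f n - ?g n\<bar> \<le> of_bool (\<exists>d>K. d ^ 2 dvd n)" if "n > 0" for n
  proof (cases "\<exists>d>K. d ^ 2 dvd n")
    case True
    then show ?thesis unfolding of_bool_def by (simp only: split: if_splits) simp
  next
    case False
    then have "omega_seq a n = omega_trunc a K n"
      using omega_seq_eq_omega_trunc[of a n K, OF a1] that by blast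
    then show ?thesis by simp
  qed
  then have "\<bar>average ?f N - average ?g N\<bar> \<le> average (\<lambda>n. of_bool (\<exists>d>K. d ^ 2 dvd n)) N"
    by (rule average_close)
  also have "\<dots> \<le> 1 / real K" by (rule average_large_square_divisor_le[OF K])
  finally show ?thesis .
qed

lemma has_mean_tail_density:
  assumes "a 1 = 0"
  shows "has_mean (\<lambda>n. of_bool (m \<le> omega_seq a n)) (tail_density a m)"
  unfolding has_mean_def
proof (rule tendsto_uniform_approx)
  show "average (\<lambda>n. of_bool (m \<le> omega_trunc a K n)) \<longlonglongrightarrow> trunc_tail a K m" for K
    using has_mean_trunc_tail unfolding has_mean_def .
qed (use average_tail_close[of a, OF assms] in \<open>auto intro: trunc_tail_tendsto lim_1_over_n\<close>)

lemma tail_density_0: "tail_density a 0 = 1"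
proof -
  have "trunc_tail a K 0 = 1" for K
    using has_mean_trunc_tail[of 0 a K] has_mean_const[of 1] has_mean_unique by force
  then show ?thesis using LIMSEQ_unique[OF trunc_tail_tendsto[of a 0]] by auto
qed

text \<open>No mass escapes to infinity: up to an error \<open>1 / K\<close> the tails are those of a bounded function.\<close>
lemma tail_density_tendsto_0:
  assumes a1: "a 1 = 0"
  shows "tail_density a \<longlonglongrightarrow> 0"
proof (rule tendsto_uniform_approx)
  show "trunc_tail a K \<longlonglongrightarrow> 0" for K
  proof (rule tendsto_eventually)
    show "\<forall>\<^sub>F m in sequentially. trunc_tail a K m = 0"
      using eventually_gt_at_top by eventually_elim (rule trunc_tail_eq_0)
  qed
  show "(\<lambda>K. 1 / real K) \<longlonglongrightarrow> 0" by (rule lim_1_over_n)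
  show "\<bar>tail_density a m - trunc_tail a K m\<bar> \<le> 1 / real K" if K: "K \<ge> 1" for K m
  proof (rule LIMSEQ_le_const2)
    show "(\<lambda>N. \<bar>average (\<lambda>n. of_bool (m \<le> omega_seq a n)) N
          - average (\<lambda>n. of_bool (m \<le> omega_trunc a K n)) N\<bar>)
        \<longlonglongrightarrow> \<bar>tail_density a m - trunc_tail a K m\<bar>"
      using has_mean_tail_density[of a m, OF a1] has_mean_trunc_tail[of m a K] unfolding has_mean_def
      by (intro tendsto_rabs tendsto_diff)
  qed (use average_tail_close[of a, OF a1 K] in blast)
qed auto

section \<open>The limiting distribution\<close>

lemma has_natural_density_omega_seq_eq:
  assumes "a 1 = 0"
  shows "has_natural_density {n. 0 < n \<and> omega_seq a n = m} (tail_density a m - tail_density a (Suc m))"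
proof (rule has_mean_imp_has_natural_density)
  let ?h = "\<lambda>n. of_bool (m \<le> omega_seq a n) - of_bool (Suc m \<le> omega_seq a n) :: real"
  have "average (\<lambda>n. of_bool (n \<in> {n. 0 < n \<and> omega_seq a n = m})) = average ?h"
    unfolding average_def by (intro ext arg_cong2[of _ _ _ _ divide] sum.cong) auto
  then show "has_mean (\<lambda>n. of_bool (n \<in> {n. 0 < n \<and> omega_seq a n = m}))
      (tail_density a m - tail_density a (Suc m))"
    using has_mean_diff[OF has_mean_tail_density[of a m, OF assms] has_mean_tail_density[of a "Suc m", OF assms]]
    by (simp add: has_mean_def)
qed

lemma omega_density_eq:
  "a 1 = 0 \<Longrightarrow> omega_density a m = tail_density a m - tail_density a (Suc m)"
  unfolding omega_density_def by (intro natural_density_eqI has_natural_density_omega_seq_eq)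

lemma omega_density_nonneg:
  assumes "a 1 = 0"
  shows "0 \<le> omega_density a m"
proof -
  have "tail_density a (Suc m) \<le> tail_density a m"
    by (rule has_mean_mono[OF has_mean_tail_density[of a, OF assms] has_mean_tail_density[of a, OF assms]]) auto
  then show ?thesis using assms by (simp add: omega_density_eq)
qed

lemma omega_density_sums_1:
  assumes "a 1 = 0"
  shows "omega_density a sums 1"
proof -
  have "omega_density a = (\<lambda>m. tail_density a m - tail_density a (Suc m))"
    using omega_density_eq[of a, OF assms] by (rule ext)
  then show ?thesis
    using telescope_sums'[OF tail_density_tendsto_0[of a, OF assms]] by (simp add: tail_density_0)
qed

section \<open>The expectation\<close>

lemma infsum_ennreal_eq_SUP:
  fixes f :: "'a \<Rightarrow> ennreal"
  assumes "incseq F" "\<And>K. finite (F K)" "(\<Union>K. F K) = A"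
  shows "infsum f A = (SUP K::nat. sum f (F K))"
proof -
  have chain: "subset.chain UNIV (range F)"
    using assms(1) by (auto simp: subset_chain_def incseq_def) (meson nat_le_linear subsetD)
  have "infsum f A = (SUP G\<in>{G. finite G \<and> G \<subseteq> A}. sum f G)"
    by (rule nonneg_infsum_complete) simp
  also have "\<dots> = (SUP K. sum f (F K))"
  proof (rule antisym)
    show "(SUP G\<in>{G. finite G \<and> G \<subseteq> A}. sum f G) \<le> (SUP K. sum f (F K))"
    proof (rule SUP_least)
      fix G assume G: "G \<in> {G. finite G \<and> G \<subseteq> A}"
      then have "finite G" "G \<subseteq> \<Union>(range F)" using assms(3) by auto
      then obtain B where "B \<in> range F" "G \<subseteq> B"
        by (rule finite_subset_Union_chain[OF _ _ _ chain]) auto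
      then obtain K where "G \<subseteq> F K" by blast
      then show "sum f G \<le> (SUP K. sum f (F K))"
        using assms by (intro SUP_upper2[of K] sum_mono2) auto
    qed
    show "(SUP K. sum f (F K)) \<le> (SUP G\<in>{G. finite G \<and> G \<subseteq> A}. sum f G)"
      using assms by (intro SUP_mono) blast
  qed
  finally show ?thesis .
qed

text \<open>
  The inner and the outer sum are suprema over separate cut-offs; by monotonicity in both the
  supremum may be taken along the diagonal, where the cut-offs match those of \<open>omega_trunc\<close>.
\<close>
lemma infsum_primes_exponents_eq_SUP:
  fixes u :: "nat \<Rightarrow> nat \<Rightarrow> ennreal"
  shows "(\<Sum>\<^sub>\<infinity>p\<in>{p. prime p}. \<Sum>\<^sub>\<infinity>j\<in>{2..}. u p j) =
    (SUP K. \<Sum>p | prime p \<and> p \<le> K. \<Sum>j\<in>{2..<2*K}. u p j)"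
proof -
  let ?P = "\<lambda>K. {p::nat. prime p \<and> p \<le> K}"
  let ?J = "\<lambda>K. {2..<2*K} :: nat set"
  have inner: "infsum (u p) {2..} = (SUP L. sum (u p) (?J L))" for p
  proof (rule infsum_ennreal_eq_SUP)
    show "(\<Union>K. ?J K) = {2..}"
    proof (intro equalityI subsetI)
      fix j :: nat assume "j \<in> {2..}"
      then have "j \<in> ?J j" by simp
      then show "j \<in> (\<Union>K. ?J K)" by blast
    qed auto
  qed (auto simp: incseq_def)
  have "(\<Sum>\<^sub>\<infinity>p\<in>{p. prime p}. \<Sum>\<^sub>\<infinity>j\<in>{2..}. u p j) = (SUP K. \<Sum>p\<in>?P K. SUP L. sum (u p) (?J L))"
    unfolding inner by (rule infsum_ennreal_eq_SUP) (auto simp: incseq_def)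
  also have "\<dots> = (SUP K. SUP L. \<Sum>p\<in>?P K. sum (u p) (?J L))"
    by (subst ennreal_SUP_sum) (auto simp: incseq_def intro!: sum_mono2)
  also have "\<dots> = (SUP K. \<Sum>p\<in>?P K. sum (u p) (?J K))"
  proof (rule antisym)
    show "(SUP K. SUP L. \<Sum>p\<in>?P K. sum (u p) (?J L)) \<le> (SUP K. \<Sum>p\<in>?P K. sum (u p) (?J K))"
    proof (intro SUP_least)
      fix K L
      have "(\<Sum>p\<in>?P K. sum (u p) (?J L)) \<le> (\<Sum>p\<in>?P K. sum (u p) (?J (max K L)))"
        by (intro sum_mono sum_mono2) auto
      also have "\<dots> \<le> (\<Sum>p\<in>?P (max K L). sum (u p) (?J (max K L)))"
        by (intro sum_mono2) auto
      also have "\<dots> \<le> (SUP K. \<Sum>p\<in>?P K. sum (u p) (?J K))" by (rule SUP_upper) simp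
      finally show "(\<Sum>p\<in>?P K. sum (u p) (?J L)) \<le> (SUP K. \<Sum>p\<in>?P K. sum (u p) (?J K))" .
    qed
    show "(SUP K. \<Sum>p\<in>?P K. sum (u p) (?J K)) \<le> (SUP K. SUP L. \<Sum>p\<in>?P K. sum (u p) (?J L))"
    proof (rule SUP_mono')
      show "(\<Sum>p\<in>?P K. sum (u p) (?J K)) \<le> (SUP L. \<Sum>p\<in>?P K. sum (u p) (?J L))" for K
        by (rule SUP_upper) simp
    qed
  qed
  finally show ?thesis .
qed

text \<open>
  The tail densities of the truncations increase to \<open>tail_density a\<close>, so monotone convergence
  passes the layer-cake formula to the limit.
\<close>
lemma suminf_tail_density:
  "(\<Sum>m. ennreal (tail_density a (Suc m))) =
     (\<Sum>\<^sub>\<infinity>p\<in>{p::nat. prime p}. \<Sum>\<^sub>\<infinity>j\<in>{2..}.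
        ennreal (real (a j) * (1 / real p ^ j - 1 / real p ^ (j + 1))))"
proof -
  let ?c = "\<lambda>p j. real (a j) * (1 / real p ^ j - 1 / real p ^ (j + 1))"
  have c: "0 \<le> ?c p j" if "prime p" for p j
  proof -
    have "1 / real p ^ (j + 1) \<le> 1 / real p ^ j"
      using prime_ge_1_nat[OF that] by (intro divide_left_mono power_increasing) auto
    then show ?thesis by simp
  qed
  have inc: "incseq (\<lambda>K. ennreal (trunc_tail a K m))" for m
    by (auto simp: incseq_def intro: ennreal_leI trunc_tail_mono)
  have "(\<lambda>K. ennreal (trunc_tail a K m)) \<longlonglongrightarrow> ennreal (tail_density a m)" for m
    by (intro tendsto_ennrealI trunc_tail_tendsto)
  then have "ennreal (tail_density a m) = (SUP K. ennreal (trunc_tail a K m))" for m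
    using LIMSEQ_SUP[OF inc] LIMSEQ_unique by blast
  then have "(\<Sum>m. ennreal (tail_density a (Suc m))) = (\<Sum>m. SUP K. ennreal (trunc_tail a K (Suc m)))"
    by simp
  also have "\<dots> = (SUP K. \<Sum>m. ennreal (trunc_tail a K (Suc m)))"
    by (rule ennreal_suminf_SUP_eq) (rule inc)
  also have "\<dots> = (SUP K. \<Sum>p | prime p \<and> p \<le> K. \<Sum>j\<in>{2..<2*K}. ennreal (?c p j))"
  proof (rule SUP_cong[OF refl])
    fix K
    have "(\<Sum>m. ennreal (trunc_tail a K (Suc m)))
        = (\<Sum>p | prime p \<and> p \<le> K. ennreal (\<Sum>j\<in>{2..<2*K}. ?c p j))"
      unfolding suminf_trunc_tail by (rule sum_ennreal[symmetric]) (intro sum_nonneg c, simp)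
    also have "\<dots> = (\<Sum>p | prime p \<and> p \<le> K. \<Sum>j\<in>{2..<2*K}. ennreal (?c p j))"
      by (intro sum.cong refl sum_ennreal[symmetric] c) simp
    finally show "(\<Sum>m. ennreal (trunc_tail a K (Suc m)))
        = (\<Sum>p | prime p \<and> p \<le> K. \<Sum>j\<in>{2..<2*K}. ennreal (?c p j))" .
  qed
  also have "\<dots> = (\<Sum>\<^sub>\<infinity>p\<in>{p. prime p}. \<Sum>\<^sub>\<infinity>j\<in>{2..}. ennreal (?c p j))"
    by (rule infsum_primes_exponents_eq_SUP[symmetric])
  finally show ?thesis .
qed

text \<open>
  The point masses determine the tail probabilities of \<open>X\<close> by induction, starting from total
  mass \<open>1\<close>.
\<close>
lemma expectation_eq_suminf_tail_density:
  assumes a1: "a 1 = 0" and M: "prob_space M" and X: "X \<in> measurable M (count_space UNIV)"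
    and dist: "\<And>m::nat. measure M {w \<in> space M. X w = m} = omega_density a m"
  shows "(\<integral>\<^sup>+ w. ennreal (real (X w)) \<partial>M) = (\<Sum>m. ennreal (tail_density a (Suc m)))"
proof -
  interpret prob_space M by fact
  note [measurable] = X
  have "prob {w \<in> space M. m \<le> X w} = tail_density a m" for m
  proof (induction m)
    case 0
    then show ?case by (simp add: tail_density_0 prob_space)
  next
    case (Suc m)
    have "{w \<in> space M. Suc m \<le> X w} = {w \<in> space M. m \<le> X w} - {w \<in> space M. X w = m}" by auto
    then have "prob {w \<in> space M. Suc m \<le> X w} = prob {w \<in> space M. m \<le> X w} - prob {w \<in> space M. X w = m}"
      by (simp only:) (rule finite_measure_Diff; auto)
    then show ?case using Suc dist a1 by (simp add: omega_density_eq)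
  qed
  then have "emeasure M {w \<in> space M. m < X w} = ennreal (tail_density a (Suc m))" for m
    by (simp add: emeasure_eq_measure Suc_le_eq[symmetric])
  then show ?thesis
    using nn_integral_nat_function[OF X] by (simp add: ennreal_of_nat_eq_real_of_nat)
qed

theorem corollary11:
  fixes a :: "nat \<Rightarrow> nat"
  assumes "a 1 = 0"
  shows "(\<forall>m. has_natural_density {n. 0 < n \<and> omega_seq a n = m} (omega_density a m))
    \<and> (\<forall>m. 0 \<le> omega_density a m)
    \<and> omega_density a sums 1
    \<and> (\<forall>(M :: 'b measure) X.
          prob_space M \<longrightarrow> X \<in> measurable M (count_space UNIV) \<longrightarrow>
          (\<forall>m::nat. measure M {w \<in> space M. X w = m} = omega_density a m) \<longrightarrow>
          (\<integral>\<^sup>+ w. ennreal (real (X w)) \<partial>M) =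
          (\<Sum>\<^sub>\<infinity>p\<in>{p::nat. prime p}. \<Sum>\<^sub>\<infinity>j\<in>{2..}.
             ennreal (real (a j) * (1 / real p ^ j - 1 / real p ^ (j + 1)))))"
proof (intro conjI allI impI)
  show "has_natural_density {n. 0 < n \<and> omega_seq a n = m} (omega_density a m)" for m
    using has_natural_density_omega_seq_eq[of a m, OF assms] omega_density_eq[of a m, OF assms]
    by (simp only:)
  show "0 \<le> omega_density a m" for m by (rule omega_density_nonneg) (rule assms)
  show "omega_density a sums 1" by (rule omega_density_sums_1) (rule assms)
next
  fix M :: "'b measure" and X :: "'b \<Rightarrow> nat"
  assume "prob_space M" "X \<in> measurable M (count_space UNIV)"
    and "\<forall>m. measure M {w \<in> space M. X w = m} = omega_density a m"
  then show "(\<integral>\<^sup>+ w. ennreal (real (X w)) \<partial>M) =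
      (\<Sum>\<^sub>\<infinity>p\<in>{p::nat. prime p}. \<Sum>\<^sub>\<infinity>j\<in>{2..}.
         ennreal (real (a j) * (1 / real p ^ j - 1 / real p ^ (j + 1))))"
    unfolding suminf_tail_density[symmetric]
    by (intro expectation_eq_suminf_tail_density[of a, OF assms]) blast+
qed

end
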